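(* Let $c\in\{0,1\}$. Then $$\partial_{z,c}(u\mathbin{ш}v)=(\partial_{z,c}u)\mathbin{ш}v+u\mathbin{ш}(\partial_{z,c}v)\qquad\text{for all }u,v\in\mathcal{A}_{\{0,1,z\}}^{0},$$ $$\partial_{z,c}(u*v)=u*(\partial_{z,c}v)\qquad\text{for all }u\in\mathcal{A}_{\{0,1\}}^{0},\ v\in\mathcal{A}_{\{0,1,z\}}^{0},$$ $$\partial_{z,c}\tau_{z}(u)=\tau_{z}(\partial_{z,c}u)\qquad\text{for all }u\in\mathcal{A}_{\{0,1,z\}}^{0}.$$ Here $\mathbin{ш}$ is the shuffle product, $*$ the stuffle product and $\tau_z$ the duality map.
   Context: Let $F=\mathbb{Q}(z)$, the field of rational functions in an indeterminate $z$. Let $\mathcal{A}_F$ be the non-commutative free (unital, associative) algebra over $\mathbb{Z}$ generated by the indeterminates $\{e_p\mid p\in F\}$. Put $\mathcal{A}_{\{0,1,z\}}=\mathbb{Z}\langle e_0,e_1,e_z\rangle\subset\mathcal{A}_F$ and $\mathcal{A}_{\{0,1\}}=\mathbb{Z}\langle e_0,e_1\rangle\subset\mathcal{A}_F$ (the subalgebras generated by the indicated indeterminates). The admissible subspaces are $$\mathcal{A}_{\{0,1,z\}}^{0}=\mathbb{Z}\oplus\mathbb{Z}e_z\oplus\bigoplus_{a\in\{1,z\},\,b\in\{0,z\}}e_a\mathcal{A}_{\{0,1,z\}}e_b,\qquad \mathcal{A}_{\{0,1\}}^{0}=\mathcal{A}_{\{0,1,z\}}^{0}\cap\mathcal{A}_{\{0,1\}}=\mathbb{Z}\oplus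 e_1\mathcal{A}_{\{0,1\}}e_0.$$ For $c\in\{0,1\}$, $\partial_{z,c}:\mathcal{A}_{\{0,1,z\}}\to\mathcal{A}_{\{0,1,z\}}$ is the $\mathbb{Z}$-linear map defined on monomials by $$\partial_{z,c}(e_{a_1}\cdots e_{a_n})=\sum_{i=1}^n\left(\delta_{\{a_i,a_{i+1}\},\{z,c\}}-\delta_{\{a_{i-1},a_i\},\{z,c\}}\right)e_{a_1}\cdots\widehat{e_{a_i}}\cdots e_{a_n},$$ with $a_0=0$, $a_{n+1}=1$, where $\delta_{S,T}$ is the Kronecker delta for two sets $S,T$ (equal to $1$ if $S=T$ as sets and $0$ otherwise), and the hat means that the factor is omitted; in particular $\partial_{z,c}(1)=0$. The shuffle product $\mathbin{ш}$ is the $\mathbb{Z}$-bilinear map $\mathcal{A}_F\times\mathcal{A}_F\to\mathcal{A}_F$ defined inductively by $w\mathbin{ш}1=1\mathbin{ш}w=w$ and $e_au\mathbin{ш}e_bv=e_a(u\mathbin{ш}e_bv)+e_b(e_au\mathbin{ш}v)$. The stuffle product $*$ is the $\mathbb{Z}$-bilinear map $\mathcal{A}_F\times\mathcal{A}_F\to\mathcal{A}_F$ defined inductively by $w*1=1*w=w$ and $e_au*e_bv=e_{ab}\left(u*e_bv+e_au*v-e_0(u*v)\right)$, where $ab$ is the product in $F$. It maps $\mathcal{A}_{\{0,1\}}\times\mathcal{A}_{\{0,1,z\}}$ into $\mathcal{A}_{\{0,1,z\}}$. The duality map $\tau_z:\mathcal{A}_{\{0,1,z\}}\to\mathcal{A}_{\{0,1,z\}}$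 is the anti-automorphism (i.e. $\mathbb{Z}$-linear with $\tau_z(uv)=\tau_z(v)\tau_z(u)$) defined by $\tau_z(e_0)=e_z-e_1$, $\tau_z(e_1)=e_z-e_0$, $\tau_z(e_z)=e_z$. *)

theory Defs
  imports
    "HOL-Library.Poly_Mapping"
    "HOL-Computational_Algebra.Fraction_Field"
    "HOL-Computational_Algebra.Polynomial"
begin

type_synonym ratfun = "rat poly fract"

definition zvar :: ratfun
  where "zvar = Fraction_Field.Fract [:0, 1:] 1"

text \<open>
  Words form a monoid under concatenation, so the ring structure that
  \<^theory>\<open>HOL-Library.Poly_Mapping\<close> puts on finitely supported integer functions on words
  (convolution) is the free unital associative ring on the letters.
\<close>

instantiation list :: (type) monoid_add
begin

definition zero_list :: "'a list" where "zero_list = []"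
definition plus_list :: "'a list \<Rightarrow> 'a list \<Rightarrow> 'a list" where "plus_list = (@)"

instance by standard (simp_all add: zero_list_def plus_list_def)

end

type_synonym free_alg = "ratfun list \<Rightarrow>\<^sub>0 int"

abbreviation mon :: "ratfun list \<Rightarrow> free_alg"
  where "mon w \<equiv> frag_of w"

definition gen :: "ratfun \<Rightarrow> free_alg"
  where "gen p = mon [p]"

lemma mon_Nil: "mon [] = 1"
  by (simp flip: single_one zero_list_def)

lemma mon_mult: "mon u * mon v = mon (u @ v)"
  by (simp add: mult_single plus_list_def)

lemma mon_eq_prod_list: "mon w = prod_list (map gen w)"
proof (induction w)
  case (Cons a w)
  then show ?case
    using mon_mult[of "[a]" w] by (simp add: gen_def)
qed (simp add: mon_Nil)

inductive_set subalg :: "ratfun set \<Rightarrow> free_alg set" for S :: "ratfun set"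
  where
    subalg_one: "1 \<in> subalg S"
  | subalg_gen: "p \<in> S \<Longrightarrow> gen p \<in> subalg S"
  | subalg_diff: "x \<in> subalg S \<Longrightarrow> y \<in> subalg S \<Longrightarrow> x - y \<in> subalg S"
  | subalg_mult: "x \<in> subalg S \<Longrightarrow> y \<in> subalg S \<Longrightarrow> x * y \<in> subalg S"

abbreviation alg01z :: "free_alg set"
  where "alg01z \<equiv> subalg {0, 1, zvar}"

abbreviation alg01 :: "free_alg set"
  where "alg01 \<equiv> subalg {0, 1}"

definition adm01z :: "free_alg set"
  where "adm01z =
    {of_int m + of_int n * gen zvar
       + (\<Sum>a\<in>{1, zvar}. \<Sum>b\<in>{0, zvar}. gen a * x a b * gen b) | m n x.
     \<forall>a\<in>{1, zvar}. \<forall>b\<in>{0, zvar}. x a b \<in> alg01z}"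

definition adm01 :: "free_alg set"
  where "adm01 = adm01z \<inter> alg01"

text \<open>
  Linear and bilinear maps are given on words and extended by \<^const>\<open>frag_extend\<close>.
  They are thereby defined on all of \<^typ>\<open>free_alg\<close>, also where only the values on
  \<^term>\<open>alg01z\<close> are meaningful.
\<close>

definition bilin_extend ::
    "(ratfun list \<Rightarrow> ratfun list \<Rightarrow> free_alg) \<Rightarrow> free_alg \<Rightarrow> free_alg \<Rightarrow> free_alg"
  where "bilin_extend f x y = frag_extend (\<lambda>u. frag_extend (f u) y) x"

lemma bilin_extend_mon: "bilin_extend f (mon u) (mon v) = f u v"
  by (simp add: bilin_extend_def)

lemma bilin_extend_diff_left: "bilin_extend f (x - x') y = bilin_extend f x y - bilin_extend f x' y"
  by (simp add: bilin_extend_def frag_extend_diff)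

lemma bilin_extend_diff_right: "bilin_extend f x (y - y') = bilin_extend f x y - bilin_extend f x y'"
  using subset_UNIV
  by (induction x rule: frag_induction) (simp_all add: bilin_extend_def frag_extend_diff)

definition set_delta :: "'a set \<Rightarrow> 'a set \<Rightarrow> int"
  where "set_delta S T = (if S = T then 1 else 0)"

text \<open>
  In \<open>bdry_word w = [a\<^sub>0, a\<^sub>1, \<dots>, a\<^sub>n, a\<^sub>n\<^sub>+\<^sub>1]\<close> the letter \<open>a\<^sub>i\<close> has index \<open>i\<close>, whereas in \<open>w\<close> it has index
  \<open>i - 1\<close>.
\<close>

definition bdry_word :: "ratfun list \<Rightarrow> ratfun list"
  where "bdry_word w = 0 # w @ [1]"

definition partial_word :: "ratfun \<Rightarrow> ratfun list \<Rightarrow> free_alg"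
  where "partial_word c w =
    (\<Sum>i = 1..length w.
       of_int (set_delta {bdry_word w ! i, bdry_word w ! (i + 1)} {zvar, c}
               - set_delta {bdry_word w ! (i - 1), bdry_word w ! i} {zvar, c})
       * mon (take (i - 1) w @ drop i w))"

definition partial_z :: "ratfun \<Rightarrow> free_alg \<Rightarrow> free_alg"
  where "partial_z c = frag_extend (partial_word c)"

fun shuffle_word :: "ratfun list \<Rightarrow> ratfun list \<Rightarrow> free_alg"
  where
    "shuffle_word u [] = mon u"
  | "shuffle_word [] v = mon v"
  | "shuffle_word (a # u) (b # v) =
       gen a * shuffle_word u (b # v) + gen b * shuffle_word (a # u) v"

definition shuffle :: "free_alg \<Rightarrow> free_alg \<Rightarrow> free_alg"
  where "shuffle = bilin_extend shuffle_word"

fun stuffle_word :: "ratfun list \<Rightarrow> ratfun list \<Rightarrow> free_alg"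
  where
    "stuffle_word u [] = mon u"
  | "stuffle_word [] v = mon v"
  | "stuffle_word (a # u) (b # v) =
       gen (a * b) * (stuffle_word u (b # v) + stuffle_word (a # u) v - gen 0 * stuffle_word u v)"

definition stuffle :: "free_alg \<Rightarrow> free_alg \<Rightarrow> free_alg"
  where "stuffle = bilin_extend stuffle_word"

definition tau_letter :: "ratfun \<Rightarrow> free_alg"
  where "tau_letter p =
    (if p = 0 then gen zvar - gen 1
     else if p = 1 then gen zvar - gen 0
     else gen p)"

definition tau_word :: "ratfun list \<Rightarrow> free_alg"
  where "tau_word w = prod_list (map tau_letter (rev w))"

definition tau_z :: "free_alg \<Rightarrow> free_alg"
  where "tau_z = frag_extend tau_word"

lemma zvar_neq: "zvar \<noteq> 0" "zvar \<noteq> 1"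
  by (simp_all add: zvar_def Zero_fract_def One_fract_def eq_fract one_pCons)

lemma tau_z_one: "tau_z 1 = 1"
  by (simp add: tau_z_def tau_word_def flip: mon_Nil)

lemma tau_z_gen:
  "tau_z (gen 0) = gen zvar - gen 1"
  "tau_z (gen 1) = gen zvar - gen 0"
  "tau_z (gen zvar) = gen zvar"
  by (simp_all add: tau_z_def gen_def[of 0] gen_def[of 1] gen_def[of zvar]
      tau_word_def tau_letter_def zvar_neq)

lemma tau_z_diff: "tau_z (x - y) = tau_z x - tau_z y"
  by (simp add: tau_z_def frag_extend_diff)

lemma tau_z_mult: "tau_z (x * y) = tau_z y * tau_z x"
  using subset_UNIV
proof (induction x rule: frag_induction)
  case (one u)
  show ?case
    using subset_UNIV
  proof (induction y rule: frag_induction)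
    case (one v)
    show ?case
      by (simp add: mon_mult tau_z_def tau_word_def)
  next
    case (diff a b)
    then show ?case
      by (simp add: tau_z_diff right_diff_distrib left_diff_distrib)
  qed (simp add: tau_z_def)
next
  case (diff a b)
  then show ?case
    by (simp add: tau_z_diff right_diff_distrib left_diff_distrib)
qed (simp add: tau_z_def)

end

theory Submission
  imports Defs
begin

text \<open>
  Call two letters adjacent when they are \<open>z\<close> and \<open>c\<close> in some order. Grouping the terms of
  \<open>\<partial>\<^sub>z\<^sub>,\<^sub>c w\<close> by the pair of neighbours that carries the Kronecker delta, instead of by the omitted
  letter, shows that the operator contracts adjacent neighbours: an interior pair \<open>e\<^sub>a e\<^sub>b\<close> of
  adjacent letters is replaced by \<open>e\<^sub>b - e\<^sub>a\<close>, a last letter adjacent to \<open>1\<close> is deleted, and a first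
  letter adjacent to \<open>0\<close> is deleted with sign \<open>-1\<close>. The first two effects form the operator
  \<open>contract\<close>, which satisfies a recursion on the first letter, the last one is \<open>cut\<close>, and
  \<open>\<partial>\<^sub>z\<^sub>,\<^sub>c = contract - cut\<close> (lemma \<open>partial_z_eq\<close>).

  Shuffle: each of the two operators is a derivation on all words. Neighbours in a shuffle that
  come from different factors occur in both orders, and \<open>e\<^sub>b - e\<^sub>a\<close> is antisymmetric, so only
  contractions inside one factor survive.

  Stuffle: a word \<open>u\<close> in \<open>e\<^sub>0, e\<^sub>1\<close> has no adjacent letters, but \<open>contract\<close> does not simply pass to
  the second factor: \<open>contract (e\<^sub>a u * v) = e\<^sub>a u * contract v + u * J\<^sub>0 v\<close>, where \<open>J\<^sub>0 v\<close> is what a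
  letter \<open>e\<^sub>0\<close> put in front of \<open>v\<close> would contribute (lemma \<open>contract_stuffle_word\<close>). If the first
  factor starts with \<open>e\<^sub>1\<close>, then \<open>cut\<close> produces the same defect, and the two cancel.

  Duality: interior contraction nearly commutes with \<open>\<tau>\<^sub>z\<close>. With \<open>B(a, b) = e\<^sub>b - e\<^sub>a\<close> for adjacent
  letters and \<open>0\<close> otherwise, extended bilinearly,
  \<open>B(\<tau> b, \<tau> a) - \<tau> B(a, b) = \<phi>(a) \<tau>(b) - \<phi>(b) \<tau>(a)\<close> with \<open>\<phi>(a) = 0\<close> if \<open>a = 1 - c\<close> and \<open>\<phi>(a) = -1\<close>
  otherwise. Summed over a word these defects telescope to two boundary terms (lemma
  \<open>contract_tau_word\<close>), and these match the boundary terms of \<open>\<partial>\<^sub>z\<^sub>,\<^sub>c\<close> exactly when the word does not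
  start with \<open>e\<^sub>0\<close> and does not end with \<open>e\<^sub>1\<close>.
\<close>

section \<open>Words and linear maps\<close>

lemma mon_Cons: "mon (a # w) = gen a * mon w"
  using mon_mult[of "[a]" w] by (simp add: gen_def)

lemma mon_snoc: "mon (w @ [a]) = mon w * gen a"
  using mon_mult[of w "[a]"] by (simp add: gen_def)

lemmas mon_simps = mon_Nil mon_Cons

lemma linear_ext:
  fixes f g :: "free_alg \<Rightarrow> free_alg"
  assumes "\<And>x y. f (x - y) = f x - f y" "\<And>x y. g (x - y) = g x - g y"
    and "\<And>w. w \<in> S \<Longrightarrow> f (mon w) = g (mon w)" and "Poly_Mapping.keys x \<subseteq> S"
  shows "f x = g x"
  using assms(4)
proof (induction x rule: frag_induction)
  case zero
  show ?case using assms(1)[of 0 0] assms(2)[of 0 0] by simp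
qed (use assms in auto)

lemma bilinear_ext:
  fixes f g :: "free_alg \<Rightarrow> free_alg \<Rightarrow> free_alg"
  assumes "\<And>x y z. f (x - y) z = f x z - f y z" "\<And>x y z. f z (x - y) = f z x - f z y"
    and "\<And>x y z. g (x - y) z = g x z - g y z" "\<And>x y z. g z (x - y) = g z x - g z y"
    and words: "\<And>v w. v \<in> S \<Longrightarrow> w \<in> S' \<Longrightarrow> f (mon v) (mon w) = g (mon v) (mon w)"
    and "Poly_Mapping.keys x \<subseteq> S" "Poly_Mapping.keys y \<subseteq> S'"
  shows "f x y = g x y"
proof (rule linear_ext[where f = "\<lambda>x. f x y" and g = "\<lambda>x. g x y" and S = S])
  fix v assume v: "v \<in> S"
  show "f (mon v) y = g (mon v) y"
    by (rule linear_ext[where f = "f (mon v)" and g = "g (mon v)" and S = S'])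
       (rule assms(2,4) words[OF v] assms(7) | assumption)+
qed (rule assms)+

lemma diff_imp_linear:
  fixes f :: "free_alg \<Rightarrow> free_alg"
  assumes "\<And>x y. f (x - y) = f x - f y"
  shows "f 0 = 0" "f (- x) = - f x" "f (x + y) = f x + f y"
proof -
  show 0: "f 0 = 0" using assms[of 0 0] by simp
  show m: "f (- x) = - f x" for x using assms[of 0 x] 0 by simp
  show "f (x + y) = f x + f y" using assms[of x "- y"] m[of y] by simp
qed

section \<open>Contraction along the edges of a graph on the letters\<close>

text \<open>
  The relation \<open>d\<close> is the set of edges. The predicate \<open>r\<close> tells which last letters are deleted: it
  is adjacency to the right boundary letter \<open>1\<close> in the application, and false when only interior
  contractions are wanted, as for the duality. \<open>junction_word d r a w\<close> is the contribution of the
  pair formed by \<open>a\<close> and its right neighbour in the word \<open>a # w\<close>.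
\<close>

fun junction_word :: "(ratfun \<Rightarrow> ratfun \<Rightarrow> bool) \<Rightarrow> (ratfun \<Rightarrow> bool) \<Rightarrow> ratfun \<Rightarrow> ratfun list \<Rightarrow> free_alg"
  where
    "junction_word d r a [] = (if r a then 1 else 0)"
  | "junction_word d r a (b # w) = (if d a b then (gen b - gen a) * mon w else 0)"

fun contract_word :: "(ratfun \<Rightarrow> ratfun \<Rightarrow> bool) \<Rightarrow> (ratfun \<Rightarrow> bool) \<Rightarrow> ratfun list \<Rightarrow> free_alg"
  where
    "contract_word d r [] = 0"
  | "contract_word d r (a # w) = gen a * contract_word d r w + junction_word d r a w"

fun cut_word :: "(ratfun \<Rightarrow> bool) \<Rightarrow> ratfun list \<Rightarrow> free_alg"
  where
    "cut_word l [] = 0"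
  | "cut_word l (a # w) = (if l a then mon w else 0)"

definition junction :: "(ratfun \<Rightarrow> ratfun \<Rightarrow> bool) \<Rightarrow> (ratfun \<Rightarrow> bool) \<Rightarrow> ratfun \<Rightarrow> free_alg \<Rightarrow> free_alg"
  where "junction d r a = frag_extend (junction_word d r a)"

definition contract :: "(ratfun \<Rightarrow> ratfun \<Rightarrow> bool) \<Rightarrow> (ratfun \<Rightarrow> bool) \<Rightarrow> free_alg \<Rightarrow> free_alg"
  where "contract d r = frag_extend (contract_word d r)"

definition cut :: "(ratfun \<Rightarrow> bool) \<Rightarrow> free_alg \<Rightarrow> free_alg"
  where "cut l = frag_extend (cut_word l)"

lemma linear_diff:
  "junction d r a (x - y) = junction d r a x - junction d r a y"
  "contract d r (x - y) = contract d r x - contract d r y"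
  "cut l (x - y) = cut l x - cut l y"
  "partial_z c (x - y) = partial_z c x - partial_z c y"
  "shuffle (x - y) z = shuffle x z - shuffle y z"
  "shuffle z (x - y) = shuffle z x - shuffle z y"
  "stuffle (x - y) z = stuffle x z - stuffle y z"
  "stuffle z (x - y) = stuffle z x - stuffle z y"
  by (simp_all add: junction_def contract_def cut_def partial_z_def shuffle_def stuffle_def
      frag_extend_diff bilin_extend_diff_left bilin_extend_diff_right)

lemmas linear_simps = linear_diff tau_z_diff
  diff_imp_linear[of "junction d r a" for d r a, OF linear_diff(1)]
  diff_imp_linear[of "contract d r" for d r, OF linear_diff(2)]
  diff_imp_linear[of "cut l" for l, OF linear_diff(3)]
  diff_imp_linear[of "partial_z c" for c, OF linear_diff(4)]
  diff_imp_linear[of "\<lambda>x. shuffle x z" for z, OF linear_diff(5)]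
  diff_imp_linear[of "\<lambda>x. shuffle z x" for z, OF linear_diff(6)]
  diff_imp_linear[of "\<lambda>x. stuffle x z" for z, OF linear_diff(7)]
  diff_imp_linear[of "\<lambda>x. stuffle z x" for z, OF linear_diff(8)]
  diff_imp_linear[of tau_z, OF tau_z_diff]

lemma junction_rec:
  "junction d r a 1 = (if r a then 1 else 0)"
  "junction d r a (gen b * x) = (if d a b then (gen b - gen a) * x else 0)"
proof -
  show "junction d r a 1 = (if r a then 1 else 0)"
    by (simp add: junction_def flip: mon_Nil)
  show "junction d r a (gen b * x) = (if d a b then (gen b - gen a) * x else 0)"
    by (rule linear_ext[where S = UNIV])
       (simp_all add: junction_def frag_extend_diff algebra_simps flip: mon_Cons)
qed

lemma contract_rec:
  "contract d r 1 = 0"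
  "contract d r (gen a * x) = gen a * contract d r x + junction d r a x"
proof -
  show "contract d r 1 = 0"
    by (simp add: contract_def flip: mon_Nil)
  show "contract d r (gen a * x) = gen a * contract d r x + junction d r a x"
    by (rule linear_ext[where S = UNIV])
       (simp_all add: junction_def contract_def frag_extend_diff algebra_simps flip: mon_Cons)
qed

lemma cut_rec:
  "cut l 1 = 0"
  "cut l (gen a * x) = (if l a then x else 0)"
proof -
  show "cut l 1 = 0"
    by (simp add: cut_def flip: mon_Nil)
  show "cut l (gen a * x) = (if l a then x else 0)"
    by (rule linear_ext[where S = UNIV and f = "\<lambda>x. cut l (gen a * x)"])
       (simp_all add: cut_def frag_extend_diff right_diff_distrib flip: mon_Cons)
qed

lemma shuffle_word_Nil: "shuffle_word [] v = mon v"
  by (cases v) auto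

lemma shuffle_rec:
  "shuffle x 1 = x" "shuffle 1 x = x"
  "shuffle (gen a * x) (gen b * y) = gen a * shuffle x (gen b * y) + gen b * shuffle (gen a * x) y"
proof -
  show "shuffle x 1 = x"
    by (rule linear_ext[where S = UNIV])
       (simp_all add: linear_diff, simp add: shuffle_def bilin_extend_mon flip: mon_Nil)
  show "shuffle 1 x = x"
    by (rule linear_ext[where S = UNIV])
       (simp_all add: linear_diff,
        simp add: shuffle_def bilin_extend_mon shuffle_word_Nil flip: mon_Nil)
  show "shuffle (gen a * x) (gen b * y) = gen a * shuffle x (gen b * y) + gen b * shuffle (gen a * x) y"
    by (rule bilinear_ext[where S = UNIV and S' = UNIV])
       (simp_all add: linear_diff algebra_simps,
        simp add: shuffle_def bilin_extend_mon flip: mon_Cons)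
qed

lemma stuffle_word_Nil: "stuffle_word [] v = mon v"
  by (cases v) auto

lemma stuffle_rec:
  "stuffle x 1 = x" "stuffle 1 x = x"
  "stuffle (gen a * x) (gen b * y) =
     gen (a * b) * (stuffle x (gen b * y) + stuffle (gen a * x) y - gen 0 * stuffle x y)"
proof -
  show "stuffle x 1 = x"
    by (rule linear_ext[where S = UNIV])
       (simp_all add: linear_diff, simp add: stuffle_def bilin_extend_mon flip: mon_Nil)
  show "stuffle 1 x = x"
    by (rule linear_ext[where S = UNIV])
       (simp_all add: linear_diff,
        simp add: stuffle_def bilin_extend_mon stuffle_word_Nil flip: mon_Nil)
  show "stuffle (gen a * x) (gen b * y) =
     gen (a * b) * (stuffle x (gen b * y) + stuffle (gen a * x) y - gen 0 * stuffle x y)"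
    by (rule bilinear_ext[where S = UNIV and S' = UNIV])
       (simp_all add: linear_diff algebra_simps,
        simp add: stuffle_def bilin_extend_mon algebra_simps flip: mon_Cons)
qed

lemmas junction_simps = junction_rec junction_rec(2)[where x = 1, simplified]
lemmas contract_simps = contract_rec contract_rec(2)[where x = 1, simplified]
lemmas cut_simps = cut_rec cut_rec(2)[where x = 1, simplified]
lemmas shuffle_simps = shuffle_rec shuffle_rec(3)[where x = 1, simplified]
  shuffle_rec(3)[where y = 1, simplified] shuffle_rec(3)[where x = 1 and y = 1, simplified]
lemmas stuffle_simps = stuffle_rec stuffle_rec(3)[where x = 1, simplified]
  stuffle_rec(3)[where y = 1, simplified] stuffle_rec(3)[where x = 1 and y = 1, simplified]

text \<open>
  The left boundary letter \<open>p\<close> is arbitrary because removing the first letter \<open>a\<close> of a word leaves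
  the same sum for the remaining word, with \<open>a\<close> as its left boundary.
\<close>
lemma contract_minus_cut_word:
  fixes d :: "ratfun \<Rightarrow> ratfun \<Rightarrow> bool" and p :: ratfun and w :: "ratfun list"
  defines "k \<equiv> \<lambda>p w i. (of_int (of_bool (d ((p # w @ [1]) ! i) ((p # w @ [1]) ! (i + 1)))
               - of_bool (d ((p # w @ [1]) ! (i - 1)) ((p # w @ [1]) ! i))) :: free_alg)"
  shows "(\<Sum>i = 1..length w. k p w i * mon (take (i - 1) w @ drop i w)) =
    contract_word d (\<lambda>x. d x 1) w - cut_word (d p) w"
proof (induction w arbitrary: p)
  case (Cons a w)
  let ?S = "\<lambda>p w. \<Sum>i = 1..length w. k p w i * mon (take (i - 1) w @ drop i w)"
  have "?S p (a # w) = k p (a # w) 1 * mon w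
      + (\<Sum>i = 1..length w. k p (a # w) (Suc i) * mon (take i (a # w) @ drop i w))"
    by (simp add: sum.atLeast_Suc_atMost sum.shift_bounds_cl_Suc_ivl del: sum.cl_ivl_Suc)
  also have "(\<Sum>i = 1..length w. k p (a # w) (Suc i) * mon (take i (a # w) @ drop i w))
      = gen a * ?S a w"
    unfolding sum_distrib_left
  proof (rule sum.cong, goal_cases)
    case (2 i)
    then obtain j where "i = Suc j" by (cases i) auto
    then have "k p (a # w) (Suc i) = k a w i"
      by (simp add: k_def)
    moreover have "k a w i * gen a = gen a * k a w i"
      unfolding k_def by (rule mult_of_int_commute)
    ultimately show ?case
      using \<open>i = Suc j\<close> by (simp add: mon_Cons mult.assoc[symmetric])
  qed simp
  also have "k p (a # w) 1 * mon w + gen a * ?S a w =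
      contract_word d (\<lambda>x. d x 1) (a # w) - cut_word (d p) (a # w)"
    unfolding Cons.IH by (cases w) (simp_all add: k_def mon_simps algebra_simps)
  finally show ?case .
qed simp

section \<open>The graph whose only edge joins z and c\<close>

definition edge :: "ratfun \<Rightarrow> ratfun \<Rightarrow> ratfun \<Rightarrow> bool"
  where "edge c x y \<longleftrightarrow> {x, y} = {zvar, c}"

lemma edge_iff: "edge c x y \<longleftrightarrow> x = zvar \<and> y = c \<or> x = c \<and> y = zvar"
  by (auto simp: edge_def doubleton_eq_iff)

lemma edge_graph:
  assumes "c \<in> {0, 1}"
  shows "symp (edge c)" "irreflp (edge c)" "\<not> edge c 0 1"
  using assms zvar_neq by (auto simp: edge_iff intro!: sympI irreflpI)

lemma partial_z_eq:
  "partial_z c x = contract (edge c) (\<lambda>x. edge c x 1) x - cut (edge c 0) x"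
proof (rule linear_ext[where S = UNIV
      and g = "\<lambda>x. contract (edge c) (\<lambda>x. edge c x 1) x - cut (edge c 0) x"])
  fix w
  have "set_delta {x, y} {zvar, c} = of_bool (edge c x y)" for x y
    by (simp add: set_delta_def edge_def)
  then show "partial_z c (mon w) =
      contract (edge c) (\<lambda>x. edge c x 1) (mon w) - cut (edge c 0) (mon w)"
    using contract_minus_cut_word[where d = "edge c" and p = 0 and w = w]
    by (simp only: partial_z_def contract_def cut_def frag_extend_of partial_word_def bdry_word_def)
qed (simp_all add: linear_diff)

section \<open>Shuffle\<close>

lemma cut_shuffle_word:
  "cut l (shuffle (mon u) (mon v)) =
     shuffle (cut l (mon u)) (mon v) + shuffle (mon u) (cut l (mon v))"
  by (cases u; cases v) (auto simp: mon_simps shuffle_simps cut_simps linear_simps)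

text \<open>
  This is what the induction step of the derivation property needs about the first two letters of
  a shuffle of \<open>a # u\<close> and \<open>b # v\<close>. The pair formed by \<open>a\<close> and \<open>b\<close> arises in both summands on the left
  with opposite contributions, since \<open>d\<close> is symmetric; the pairs inside \<open>a # u\<close> and \<open>b # v\<close> remain.
\<close>
lemma junction_shuffle:
  assumes "symp d"
  shows "junction d r a (shuffle (mon u) (gen b * mon v)) + junction d r b (shuffle (gen a * mon u) (mon v))
    = shuffle (junction d r a (mon u)) (gen b * mon v) - gen b * shuffle (junction d r a (mon u)) (mon v)
      + shuffle (gen a * mon u) (junction d r b (mon v)) - gen a * shuffle (mon u) (junction d r b (mon v))"
  using sympD[OF assms, of a b] sympD[OF assms, of b a]
  by (cases u; cases v) (auto simp: mon_simps shuffle_simps junction_simps linear_simps algebra_simps)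

lemma contract_shuffle_word:
  assumes "symp d"
  shows "contract d r (shuffle (mon u) (mon v)) =
    shuffle (contract d r (mon u)) (mon v) + shuffle (mon u) (contract d r (mon v))"
proof (induction u arbitrary: v)
  case (Cons a u)
  note IHu = this
  show ?case
  proof (induction v)
    case (Cons b v)
    show ?case
      by (simp add: mon_simps shuffle_simps contract_simps linear_simps Cons.IH[unfolded mon_Cons]
          IHu[of "b # v", unfolded mon_Cons] algebra_simps
          junction_shuffle[OF assms, of r a u b v, folded eq_diff_eq])
  qed (simp add: mon_simps shuffle_simps contract_simps linear_simps)
qed (simp add: mon_simps shuffle_simps contract_simps linear_simps)

section \<open>Stuffle\<close>

text \<open>
  In the recursion for \<open>e\<^sub>a x * e\<^sub>0 y\<close> the first and the third term cancel once the claim is known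
  for \<open>x\<close>; symmetrically for \<open>e\<^sub>0\<close> in front of the left factor.
\<close>
lemma stuffle_gen0_right: "stuffle x (gen 0 * y) = gen 0 * stuffle x y"
proof (rule bilinear_ext[where S = UNIV and S' = UNIV and f = "\<lambda>x y. stuffle x (gen 0 * y)"
      and g = "\<lambda>x y. gen 0 * stuffle x y"])
  fix u v
  show "stuffle (mon u) (gen 0 * mon v) = gen 0 * stuffle (mon u) (mon v)"
    by (induction u) (simp_all add: mon_simps stuffle_simps algebra_simps)
qed (simp_all add: linear_simps algebra_simps)

lemma stuffle_gen0_left: "stuffle (gen 0 * x) y = gen 0 * stuffle x y"
proof (rule bilinear_ext[where S = UNIV and S' = UNIV and f = "\<lambda>x y. stuffle (gen 0 * x) y"
      and g = "\<lambda>x y. gen 0 * stuffle x y"])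
  fix u v
  show "stuffle (gen 0 * mon u) (mon v) = gen 0 * stuffle (mon u) (mon v)"
    by (induction v) (simp_all add: mon_simps stuffle_simps algebra_simps)
qed (simp_all add: linear_simps algebra_simps)

text \<open>
  The case \<open>v = []\<close> is the reason for tying the right boundary predicate to adjacency with \<open>1\<close>: on
  the left \<open>b\<close> then meets the letter \<open>1\<close> in front of \<open>x\<close>, on the right it meets the boundary.
\<close>
lemma junction_stuffle:
  "junction d (\<lambda>a. d a 1) b (stuffle (gen 1 * x) (mon v)) =
     stuffle (gen 1 * x) (junction d (\<lambda>a. d a 1) b (mon v))
       - gen b * stuffle x (junction d (\<lambda>a. d a 1) b (mon v))"
  by (cases v)
     (auto simp: mon_simps stuffle_simps junction_simps linear_simps algebra_simps)

lemma contract_no_edges: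
  assumes "\<And>a b. a \<in> S \<Longrightarrow> b \<in> S \<Longrightarrow> \<not> d a b" "\<And>a. a \<in> S \<Longrightarrow> \<not> r a" "set w \<subseteq> S"
  shows "contract d r (mon w) = 0"
  using assms(3)
proof (induction w)
  case (Cons a w)
  then show ?case
    using assms(1,2) by (cases w) (auto simp: mon_simps contract_simps junction_simps)
qed (simp add: mon_simps contract_simps)

text \<open>
  Induction step for \<open>contract_stuffle_word\<close> below. The defect \<open>F v\<close> of \<open>u * v\<close> is kept abstract since
  it is \<open>0\<close> for the empty word \<open>u\<close> and \<open>u' * J\<^sub>0 v\<close> for \<open>u = a' # u'\<close>. The case \<open>a = 0\<close> follows directly as \<open>e\<^sub>0\<close> can be pulled out, and it
  enters the case \<open>a = 1\<close>, which needs an induction on \<open>v\<close>, through the correction term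
  \<open>- e\<^sub>0 (u * v)\<close> of the stuffle recursion.
\<close>
lemma contract_stuffle_step:
  fixes d :: "ratfun \<Rightarrow> ratfun \<Rightarrow> bool" and F :: "free_alg \<Rightarrow> free_alg"
  assumes d: "symp d" "irreflp d" "\<not> d 0 1"
    and a: "a \<in> {0, 1}" and u: "set u \<subseteq> {0, 1}"
  defines "r \<equiv> \<lambda>x. d x 1"
  assumes F: "\<And>v. contract d r (stuffle (mon u) (mon v)) =
      stuffle (mon u) (contract d r (mon v)) + F (mon v)"
    and F0: "\<And>v. gen 0 * F (mon v) + junction d r 0 (stuffle (mon u) (mon v)) =
      stuffle (mon u) (junction d r 0 (mon v))"
    and Fb: "\<And>b v. gen b * F (gen b * mon v) + junction d r b (stuffle (mon u) (gen b * mon v)) =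
      (if d 0 b then stuffle (mon u) ((gen b - gen 0) * mon v)
                     - (gen b - gen 0) * stuffle (mon u) (mon v) else 0)"
  shows "contract d r (stuffle (gen a * mon u) (mon v)) =
    stuffle (gen a * mon u) (contract d r (mon v)) + stuffle (mon u) (junction d r 0 (mon v))"
proof -
  have zero: "contract d r (stuffle (gen 0 * mon u) (mon v)) =
    stuffle (gen 0 * mon u) (contract d r (mon v)) + stuffle (mon u) (junction d r 0 (mon v))" for v
    using F0[of v]
    by (simp add: stuffle_gen0_left contract_simps F algebra_simps)
  have one: "contract d r (stuffle (gen 1 * mon u) (mon v)) =
    stuffle (gen 1 * mon u) (contract d r (mon v)) + stuffle (mon u) (junction d r 0 (mon v))" for v
  proof (induction v)
    case Nil
    have "contract d r (mon (1 # u)) = 0"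
      by (rule contract_no_edges[where S = "{0, 1}"])
         (use d u in \<open>auto simp: r_def dest: sympD irreflpD\<close>)
    then show ?case
      using d(3) by (simp add: mon_simps stuffle_simps contract_simps junction_simps linear_simps r_def)
  next
    case (Cons b v)
    have F0': "junction d r 0 (stuffle (mon u) (mon v)) =
        stuffle (mon u) (junction d r 0 (mon v)) - gen 0 * F (mon v)"
      unfolding eq_diff_eq using F0[of v] by (simp only: add.commute)
    have Fb': "gen b * F (gen b * mon v) =
        (if d 0 b then stuffle (mon u) ((gen b - gen 0) * mon v)
                       - (gen b - gen 0) * stuffle (mon u) (mon v) else 0)
        - junction d r b (stuffle (mon u) (gen b * mon v))"
      unfolding eq_diff_eq by (rule Fb)
    have "junction d r b (gen 0 * stuffle (mon u) (mon v)) =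
        (if d 0 b then (gen 0 - gen b) * stuffle (mon u) (mon v) else 0)"
      using sympD[OF d(1), of b 0] sympD[OF d(1), of 0 b] by (auto simp: junction_simps)
    then show ?case
      by (simp add: mon_simps stuffle_simps contract_simps linear_simps stuffle_gen0_left
          junction_simps stuffle_gen0_right F Cons.IH F[of "b # v", unfolded mon_Cons] F0' Fb'
          junction_stuffle[of d, folded r_def] algebra_simps)
  qed
  show ?thesis
    using a zero[of v] one[of v] by auto
qed

lemma contract_stuffle_word:
  fixes d :: "ratfun \<Rightarrow> ratfun \<Rightarrow> bool"
  assumes d: "symp d" "irreflp d" "\<not> d 0 1" and "a \<in> {0, 1}" "set u \<subseteq> {0, 1}"
  defines "r \<equiv> \<lambda>x. d x 1"
  shows "contract d r (stuffle (gen a * mon u) (mon v)) =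
    stuffle (gen a * mon u) (contract d r (mon v)) + stuffle (mon u) (junction d r 0 (mon v))"
  using assms(4,5)
proof (induction u arbitrary: a v)
  case Nil
  show ?case
    unfolding r_def
    by (rule contract_stuffle_step[where F = "\<lambda>_. 0"])
       (use d Nil in \<open>auto simp: mon_simps stuffle_simps linear_simps junction_simps dest: irreflpD\<close>)
next
  case (Cons a' u)
  have irr: "\<not> d b b" for b using d(2) by (auto dest: irreflpD)
  have a': "a' = 0 \<or> a' = 1" using Cons.prems by auto
  show ?case
    unfolding r_def
  proof (rule contract_stuffle_step[where F = "\<lambda>v. stuffle (mon u) (junction d r 0 v)"], goal_cases)
    case (6 v)
    show ?case using Cons.IH[of a' v] Cons.prems by (simp add: mon_simps r_def)
  next
    case (7 v)
    show ?case
      using a' by (auto simp: mon_simps stuffle_gen0_left junction_simps junction_stuffle irr r_def)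
  next
    case (8 b v)
    show ?case
      using a' sympD[OF d(1), of b 0] sympD[OF d(1), of 0 b]
      by (auto simp: mon_simps stuffle_gen0_left stuffle_gen0_right stuffle_simps
          junction_simps linear_simps irr r_def algebra_simps)
  qed (use d Cons.prems in auto)
qed

text \<open>
  As \<open>e\<^sub>1 x * e\<^sub>b y = e\<^sub>b (x * e\<^sub>b y + e\<^sub>1 x * y - e\<^sub>0 (x * y))\<close>, cutting the first letter gives \<open>e\<^sub>1 x * y\<close>,
  which is the expected term, plus \<open>x * (e\<^sub>b - e\<^sub>0) y\<close>, which is the defect of
  \<open>contract_stuffle_word\<close>.
\<close>
lemma cut_stuffle_word:
  assumes "\<not> d 0 1"
  shows "cut (d 0) (stuffle (gen 1 * x) (mon v)) =
    stuffle (gen 1 * x) (cut (d 0) (mon v)) + stuffle x (junction d (\<lambda>a. d a 1) 0 (mon v))"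
  using assms
  by (cases v)
     (auto simp: mon_simps stuffle_simps cut_simps junction_simps linear_simps
        stuffle_gen0_right algebra_simps)

section \<open>Duality\<close>

lemma tau_z_simps: "tau_z (gen a * x) = tau_z x * tau_letter a"
  by (simp add: tau_z_mult) (simp add: tau_z_def gen_def tau_word_def)

text \<open>
  Since \<open>\<tau>\<^sub>z\<close> reverses words, removing the first letter of \<open>w\<close> removes the last factor of \<open>\<tau>\<^sub>z w\<close>; so
  contraction is also needed as a recursion on the last letter.
\<close>
lemma contract_last_pair:
  "contract d (\<lambda>_. False) (x * (gen a * gen b)) =
     contract d (\<lambda>_. False) (x * gen a) * gen b + (if d a b then x * (gen b - gen a) else 0)"
proof (rule linear_ext[where S = UNIV and f = "\<lambda>x. contract d (\<lambda>_. False) (x * (gen a * gen b))"])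
  fix w
  show "contract d (\<lambda>_. False) (mon w * (gen a * gen b)) =
     contract d (\<lambda>_. False) (mon w * gen a) * gen b + (if d a b then mon w * (gen b - gen a) else 0)"
  proof (induction w)
    case Nil
    show ?case
      by (simp add: mon_simps contract_simps junction_simps)
  next
    case (Cons e w)
    then show ?case
      by (cases w) (auto simp: mon_simps contract_simps junction_simps algebra_simps)
  qed
qed (auto simp: linear_simps algebra_simps)

lemma contract_right_boundary:
  "contract d r (x * gen a) = contract d (\<lambda>_. False) (x * gen a) + (if r a then x else 0)"
proof (rule linear_ext[where S = UNIV and f = "\<lambda>x. contract d r (x * gen a)"
      and g = "\<lambda>x. contract d (\<lambda>_. False) (x * gen a) + (if r a then x else 0)"])
  fix w
  show "contract d r (mon w * gen a) =
     contract d (\<lambda>_. False) (mon w * gen a) + (if r a then mon w else 0)"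
  proof (induction w)
    case Nil
    show ?case
      by (simp add: mon_simps contract_simps junction_simps)
  next
    case (Cons e w)
    then show ?case
      by (cases w) (auto simp: mon_simps contract_simps junction_simps algebra_simps)
  qed
qed (auto simp: linear_simps algebra_simps)

text \<open>
  The last three terms are \<open>\<tau>\<^sub>z\<close> applied to the contraction of the pair \<open>a, b\<close>, plus
  \<open>\<phi>(a) \<tau>(b) - \<phi>(b) \<tau>(a)\<close> for the function \<open>\<phi>\<close> that is \<open>0\<close> at \<open>1 - c\<close> and \<open>-1\<close> elsewhere. This splitting
  of the defect is a coboundary, which is why it telescopes along a word.
\<close>
lemma contract_tau_step:
  assumes c: "c \<in> {0, 1}" and ab: "a \<in> {0, 1, zvar}" "b \<in> {0, 1, zvar}"
  shows "contract (edge c) (\<lambda>_. False) (x * (tau_letter b * tau_letter a)) =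
    contract (edge c) (\<lambda>_. False) (x * tau_letter b) * tau_letter a
    + (if edge c a b then x * (tau_letter b - tau_letter a) else 0)
    - (if a = 1 - c then 0 else x * tau_letter b) + (if b = 1 - c then 0 else x * tau_letter a)"
proof -
  have t: "tau_letter 0 = gen zvar - gen 1" "tau_letter 1 = gen zvar - gen 0" "tau_letter zvar = gen zvar"
    by (simp_all add: tau_letter_def zvar_neq)
  show ?thesis
    using c ab
    by (elim insertE emptyE)
       (simp_all add: t edge_iff zvar_neq zvar_neq[symmetric] right_diff_distrib left_diff_distrib
         linear_simps contract_last_pair)
qed

text \<open>
  Telescoping: multiplied by \<open>\<tau>(a)\<close>, the term that the induction hypothesis has for the first letter
  \<open>b\<close> of \<open>b # w\<close> cancels against the last term of \<open>contract_tau_step\<close>.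
\<close>
lemma contract_tau_word:
  assumes c: "c \<in> {0, 1}" and "set (a # w) \<subseteq> {0, 1, zvar}"
  shows "contract (edge c) (\<lambda>_. False) (tau_z (mon (a # w))) =
    tau_z (contract (edge c) (\<lambda>_. False) (mon (a # w)))
    - (if a = 1 - c then 0 else tau_z (mon w))
    + (if last (a # w) = 1 - c then 0 else tau_z (mon (butlast (a # w))))"
  using assms(2)
proof (induction w arbitrary: a)
  case Nil
  have "contract (edge c) (\<lambda>_. False) (tau_letter a) = 0"
    by (auto simp: tau_letter_def linear_simps contract_simps junction_simps)
  then show ?case
    by (simp add: mon_simps tau_z_simps[of a 1, simplified] tau_z_one linear_simps
        contract_simps junction_simps)
next
  case (Cons b w)
  have "contract (edge c) (\<lambda>_. False) (tau_z (mon (a # b # w))) =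
      contract (edge c) (\<lambda>_. False) (tau_z (mon w) * (tau_letter b * tau_letter a))"
    by (simp add: mon_simps tau_z_simps mult.assoc)
  then show ?case
    using Cons.prems Cons.IH[of b] contract_tau_step[OF c, of a b "tau_z (mon w)"]
    by (simp add: mon_simps tau_z_simps linear_simps contract_simps junction_simps
        left_diff_distrib right_diff_distrib distrib_right)
qed

section \<open>Words occurring in admissible elements\<close>

lemma keys_subalg: "x \<in> subalg S \<Longrightarrow> Poly_Mapping.keys x \<subseteq> lists S"
proof (induction rule: subalg.induct)
  case subalg_one
  show ?case by (simp flip: mon_Nil)
next
  case (subalg_gen p)
  then show ?case by (simp add: gen_def)
next
  case (subalg_diff x y)
  then show ?case using keys_diff[of x y] by blast
next
  case (subalg_mult x y)
  then show ?case using keys_mult[of x y] by (fastforce simp: plus_list_def)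
qed

lemma keys_adm01z:
  assumes "x \<in> adm01z"
  shows "Poly_Mapping.keys x \<subseteq> {w. set w \<subseteq> {0, 1, zvar} \<and> (w \<noteq> [] \<longrightarrow> hd w \<noteq> 0 \<and> last w \<noteq> 1)}"
    (is "_ \<subseteq> ?W")
proof -
  obtain m n y where x: "x = of_int m + of_int n * gen zvar
       + (\<Sum>a\<in>{1, zvar}. \<Sum>b\<in>{0, zvar}. gen a * y a b * gen b)"
    and y: "\<forall>a\<in>{1, zvar}. \<forall>b\<in>{0, zvar}. y a b \<in> alg01z"
    using assms unfolding adm01z_def by blast
  have int: "Poly_Mapping.keys (of_int k :: free_alg) \<subseteq> {[]}" for k
    by (simp flip: single_of_int zero_list_def)
  have "Poly_Mapping.keys (of_int m :: free_alg) \<subseteq> ?W"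
    using int[of m] by auto
  moreover have "Poly_Mapping.keys (of_int n * gen zvar) \<subseteq> ?W"
    using keys_mult[of "of_int n" "gen zvar"] int[of n] zvar_neq
    by (fastforce simp: plus_list_def gen_def)
  moreover have "Poly_Mapping.keys (gen a * y a b * gen b) \<subseteq> ?W"
    if "a \<in> {1, zvar}" "b \<in> {0, zvar}" for a b
  proof
    fix w assume "w \<in> Poly_Mapping.keys (gen a * y a b * gen b)"
    then obtain v where v: "v \<in> Poly_Mapping.keys (gen a * y a b)" "w = v @ [b]"
      using keys_mult[of "gen a * y a b" "gen b"] by (auto simp: plus_list_def gen_def)
    then obtain u where u: "u \<in> Poly_Mapping.keys (y a b)" "v = a # u"
      using keys_mult[of "gen a" "y a b"] by (auto simp: plus_list_def gen_def)
    have "y a b \<in> alg01z" using y that by blast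
    from keys_subalg[OF this] u(1) have "set u \<subseteq> {0, 1, zvar}" by auto
    then show "w \<in> ?W" using that zvar_neq v(2) u(2) by auto
  qed
  ultimately show ?thesis
    unfolding x by (intro order_trans[OF keys_add] order_trans[OF keys_sum] Un_least UN_least)
qed

lemma keys_adm01:
  assumes "x \<in> adm01"
  shows "Poly_Mapping.keys x \<subseteq> {w. w = [] \<or> (\<exists>u. w = 1 # u \<and> set u \<subseteq> {0, 1})}"
proof
  fix w assume w: "w \<in> Poly_Mapping.keys x"
  have "x \<in> adm01z" "x \<in> alg01" using assms by (auto simp: adm01_def)
  with w have "w \<noteq> [] \<longrightarrow> hd w \<noteq> 0" "set w \<subseteq> {0, 1}"
    using keys_adm01z[of x] keys_subalg[of x "{0, 1}"] by auto
  then show "w \<in> {w. w = [] \<or> (\<exists>u. w = 1 # u \<and> set u \<subseteq> {0, 1})}"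
    by (cases w) auto
qed

section \<open>The three relations\<close>

lemma partial_shuffle:
  assumes "c \<in> {0, 1}"
  shows "partial_z c (shuffle x y) = shuffle (partial_z c x) y + shuffle x (partial_z c y)"
proof (rule bilinear_ext[where S = UNIV and S' = UNIV and f = "\<lambda>x y. partial_z c (shuffle x y)"
    and g = "\<lambda>x y. shuffle (partial_z c x) y + shuffle x (partial_z c y)"])
  fix u v
  show "partial_z c (shuffle (mon u) (mon v)) =
      shuffle (partial_z c (mon u)) (mon v) + shuffle (mon u) (partial_z c (mon v))"
    by (simp add: partial_z_eq linear_simps contract_shuffle_word edge_graph[OF assms] cut_shuffle_word)
qed (simp_all add: linear_simps)

lemma partial_stuffle:
  assumes c: "c \<in> {0, 1}" and x: "x \<in> adm01"
  shows "partial_z c (stuffle x y) = stuffle x (partial_z c y)"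
proof (rule bilinear_ext[where S' = UNIV and f = "\<lambda>x y. partial_z c (stuffle x y)"
    and g = "\<lambda>x y. stuffle x (partial_z c y)", OF _ _ _ _ _ keys_adm01[OF x]])
  fix u v assume "u \<in> {w. w = [] \<or> (\<exists>u. w = 1 # u \<and> set u \<subseteq> {0, 1 :: ratfun})}"
  then consider "u = []" | u' where "u = 1 # u'" "set u' \<subseteq> {0, 1}" by blast
  then show "partial_z c (stuffle (mon u) (mon v)) = stuffle (mon u) (partial_z c (mon v))"
  proof cases
    case 1
    then show ?thesis by (simp add: mon_simps stuffle_simps)
  next
    case 2
    note d = edge_graph[OF c]
    show ?thesis
      using contract_stuffle_word[where d = "edge c" and a = 1 and u = u' and v = v, OF d _ 2(2)]
        cut_stuffle_word[where d = "edge c" and x = "mon u'" and v = v, OF d(3)]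
      by (simp add: 2(1) mon_simps partial_z_eq linear_simps)
  qed
qed (simp_all add: linear_simps)

lemma partial_tau:
  assumes c: "c \<in> {0, 1}" and x: "x \<in> adm01z"
  shows "partial_z c (tau_z x) = tau_z (partial_z c x)"
proof (rule linear_ext[where f = "\<lambda>x. partial_z c (tau_z x)" and g = "\<lambda>x. tau_z (partial_z c x)",
      OF _ _ _ keys_adm01z[OF x]])
  fix w :: "ratfun list"
  assume "w \<in> {w. set w \<subseteq> {0, 1, zvar} \<and> (w \<noteq> [] \<longrightarrow> hd w \<noteq> 0 \<and> last w \<noteq> 1)}"
  then have w: "set w \<subseteq> {0, 1, zvar}" "w \<noteq> [] \<Longrightarrow> hd w \<noteq> 0 \<and> last w \<noteq> 1" by auto
  show "partial_z c (tau_z (mon w)) = tau_z (partial_z c (mon w))"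
  proof (cases "w = []")
    case True
    then show ?thesis by (simp add: mon_simps tau_z_one partial_z_eq contract_simps cut_simps linear_simps)
  next
    case False
    obtain a u where au: "w = a # u" using False by (cases w) auto
    obtain v b where vb: "w = v @ [b]" using False by (cases w rule: rev_cases) auto
    have a: "a = 1 \<or> a = zvar"
      using w False by (auto simp: au)
    have b: "b = 0 \<or> b = zvar"
      using w False by (auto simp: vb)
    have last: "last (a # u) = b" "butlast (a # u) = v"
      using au vb by (metis last_snoc, metis butlast_snoc)
    \<comment> \<open>The letter \<open>z\<close> has coefficient 1 in the image of each letter under \<open>\<tau>\<^sub>z\<close>, and \<open>z\<close> is the only
      letter that can be adjacent to a boundary letter.\<close>
    have right: "contract (edge c) (\<lambda>x. edge c x 1) (y * tau_letter a) =
        contract (edge c) (\<lambda>_. False) (y * tau_letter a) + (if c = 1 then y else 0)" for y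
    proof -
      define r where "r = (\<lambda>x. edge c x 1)"
      have "\<not> r 0" "\<not> r 1" "r zvar \<longleftrightarrow> c = 1"
        using c zvar_neq by (auto simp: r_def edge_iff)
      then show ?thesis
        unfolding r_def[symmetric] using a
        by (auto simp: tau_letter_def zvar_neq right_diff_distrib linear_simps
            contract_right_boundary[of _ r])
    qed
    have left: "cut (edge c 0) (tau_letter b * y) = (if c = 0 then y else 0)" for y
      using b by (auto simp: tau_letter_def zvar_neq left_diff_distrib linear_simps cut_simps edge_iff)
    have tau_b: "tau_z (mon w) = tau_letter b * tau_z (mon v)"
      by (simp add: vb mon_snoc tau_z_mult) (simp add: tau_z_def gen_def tau_word_def)
    have tau_a: "tau_z (mon w) = tau_z (mon u) * tau_letter a"
      by (simp add: au mon_simps tau_z_simps)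
    have "partial_z c (tau_z (mon w)) = contract (edge c) (\<lambda>_. False) (tau_z (mon w))
        + (if c = 1 then tau_z (mon u) else 0) - (if c = 0 then tau_z (mon v) else 0)"
      using right[of "tau_z (mon u)"] left[of "tau_z (mon v)"]
      by (simp add: partial_z_eq flip: tau_a tau_b)
    moreover have "partial_z c (mon w) = contract (edge c) (\<lambda>_. False) (mon w)
        + (if edge c b 1 then mon v else 0) - (if edge c 0 a then mon u else 0)"
    proof -
      have "cut (edge c 0) (mon w) = (if edge c 0 a then mon u else 0)"
        by (simp add: au mon_simps cut_simps)
      moreover have "contract (edge c) (\<lambda>x. edge c x 1) (mon w) =
          contract (edge c) (\<lambda>_. False) (mon w) + (if edge c b 1 then mon v else 0)"
        unfolding vb mon_snoc by (rule contract_right_boundary)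
      ultimately show ?thesis
        unfolding partial_z_eq by simp
    qed
    moreover have "contract (edge c) (\<lambda>_. False) (tau_z (mon w)) =
        tau_z (contract (edge c) (\<lambda>_. False) (mon w))
        - (if a = 1 - c then 0 else tau_z (mon u)) + (if b = 1 - c then 0 else tau_z (mon v))"
      using contract_tau_word[OF c, of a u] w(1) last by (simp add: au)
    ultimately show ?thesis
      using a b c zvar_neq by (auto simp: linear_simps edge_iff)
  qed
qed (simp_all add: linear_simps)

theorem mainTheorem1:
  fixes c :: ratfun
  assumes "c \<in> {0, 1}"
  shows "(\<forall>u\<in>adm01z. \<forall>v\<in>adm01z.
            partial_z c (shuffle u v) = shuffle (partial_z c u) v + shuffle u (partial_z c v))
       \<and> (\<forall>u\<in>adm01. \<forall>v\<in>adm01z.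
            partial_z c (stuffle u v) = stuffle u (partial_z c v))
       \<and> (\<forall>u\<in>adm01z. partial_z c (tau_z u) = tau_z (partial_z c u))"
  using assms by (blast intro: partial_shuffle partial_stuffle partial_tau)

end
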